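(* There is an absolute constant $C>0$ such that for every instance $I$ of SRMA (min-max submodular ranking for multiple agents) with integer weights, every permutation $\pi$ output by the Balanced Adaptive Greedy algorithm on $I$ (with any tie-breaking) satisfies $$\max_{i\in[k]}\sum_{j=1}^m w^{(i)}_j\,\mathrm{cov}(f^{(i)}_j,\pi)\ \le\ C\,\bigl(1+\ln(1/\epsilon)\bigr)\bigl(1+\log\min\{n,W\}\bigr)\bigl(1+\log k\bigr)\cdot \mathrm{OPT}(I).$$ That is, the algorithm has approximation ratio $O(\ln(1/\epsilon)\cdot\log(\min\{n,W\})\cdot\log k)$, where $n$ is the number of elements, $k$ is the number of agents, $\epsilon$ is the minimum non-zero marginal value among all $m\cdot k$ functions, and $W$ is the maximum total weight of all functions of an agent, over all agents.
   Context: **SRMA.** An instance consists of a ground set $U=[n]$, $k$ agents $a_1,\dots,a_k$ (set $A$), and for each agent $a_i$, monotone submodular functions $f^{(i)}_1,\dots,f^{(i)}_m:2^{[n]}\to[0,1]$ with $f^{(i)}_j(U)=1$ and weights $w^{(i)}_j\ge 1$. For a permutation $\pi$ of $U$, let $\pi(t)$ be its $t$-th element, $\pi_t=\{\pi(1),\dots,\pi(t)\}$, $\pi_0=\emptyset$. The cover time $\mathrm{cov}(f,\pi)$ is the smallest index $t\in\{1,\dots,n\}$ with $f(\pi_t)=1$. The objective value of $\pi$ is $\max_{i\in[k]}\sum_{j=1}^m w^{(i)}_j\mathrm{cov}(f^{(i)}_j,\pi)$, and $\mathrm{OPT}(I)$ is its minimum over all permutations. $\epsilon>0$ is the minimum non-zero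 marginal value: for all $S\subseteq S'$, $f^{(i)}_j(S')>f^{(i)}_j(S)$ implies $f^{(i)}_j(S')-f^{(i)}_j(S)\ge\epsilon$. $W=\max_{i}\sum_{j=1}^m w^{(i)}_j$. **Balanced Adaptive Greedy.** Elements are selected one per time $t=1,2,\dots$. Let $R^{(i)}_t$ be the set of functions of agent $a_i$ not satisfied earlier than time $t$, i.e. those $f^{(i)}_j$ with $f^{(i)}_j(\pi_{t-1})<1$, and let $w(R^{(i)}_t)$ be their total weight. Let $B_p=(2/3)^pW$. For $p=1,2,\dots$ (outer iterations), until all functions are satisfied, do the following. While the current set $\{a_i\in A: w(R^{(i)}_t)>B_p\}$ is non-empty, run inner iterations $q=1,2,\dots$: at the start of inner iteration $(p,q)$ fix $A'=\{a_i\in A: w(R^{(i)}_t)>B_p\}$ ($t$ the current time); then, as long as $|\{a_i\in A: w(R^{(i)}_t)>B_p\}|\ge\frac34|A'|$ and this set is non-empty, choose $\pi(t)\in U\setminus\pi_{t-1}$ maximizing $$F_{\pi_{t-1}}(e)=\sum_{a_i\in A'}\ \sum_{j:\,f^{(i)}_j(\pi_{t-1})<1} w^{(i)}_j\,\frac{f^{(i)}_j(\pi_{t-1}\cup\{e\})-f^{(i)}_j(\pi_{t-1})}{1-f^{(i)}_j(\pi_{t-1})}$$ and increase $t$ by 1. When no agent has $w(R^{(i)}_t)>B_p$, move on to $p+1$ (an outer iteration may be empty). Any elements left over once all functions are satisfied are appended in arbitrary order. *)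

theory Defs
  imports Complex_Main "HOL-Combinatorics.Multiset_Permutations"
begin

(* Elements, agents and the functions of an agent are numbered from 1.  A permutation of the
   ground set is a list in permutations_of_set (ground I), whose prefix of length t lists the
   first t elements. *)

record srma =
  num_elems :: nat
  num_agents :: nat
  num_funs :: nat
  fn :: "nat \<Rightarrow> nat \<Rightarrow> nat set \<Rightarrow> real"
  weight :: "nat \<Rightarrow> nat \<Rightarrow> real"

definition ground :: "srma \<Rightarrow> nat set" where
  "ground I = {1..num_elems I}"

definition agents :: "srma \<Rightarrow> nat set" where
  "agents I = {1..num_agents I}"

definition fun_ids :: "srma \<Rightarrow> nat set" where
  "fun_ids I = {1..num_funs I}"

definition submodular_on :: "'a set \<Rightarrow> ('a set \<Rightarrow> real) \<Rightarrow> bool" where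
  "submodular_on U g \<longleftrightarrow>
     (\<forall>S T. S \<subseteq> U \<longrightarrow> T \<subseteq> U \<longrightarrow> g (S \<union> T) + g (S \<inter> T) \<le> g S + g T)"

(* The values at the empty set are not assumed to be 0.  Weights are real here; integrality is a
   separate predicate. *)
definition valid_instance :: "srma \<Rightarrow> bool" where
  "valid_instance I \<longleftrightarrow>
     1 \<le> num_elems I \<and> 1 \<le> num_agents I \<and> 1 \<le> num_funs I \<and>
     (\<forall>i\<in>agents I. \<forall>j\<in>fun_ids I.
        fn I i j \<in> Pow (ground I) \<rightarrow> {0..1} \<and>
        mono_on (Pow (ground I)) (fn I i j) \<and>
        submodular_on (ground I) (fn I i j) \<and>
        fn I i j (ground I) = 1 \<and>
        1 \<le> weight I i j)"

definition integer_weights :: "srma \<Rightarrow> bool" where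
  "integer_weights I \<longleftrightarrow> (\<forall>i\<in>agents I. \<forall>j\<in>fun_ids I. weight I i j \<in> \<int>)"

definition cov :: "('a set \<Rightarrow> real) \<Rightarrow> 'a list \<Rightarrow> nat" where
  "cov g xs = (LEAST t. t \<in> {1..length xs} \<and> g (set (take t xs)) = 1)"

definition objective :: "srma \<Rightarrow> nat list \<Rightarrow> real" where
  "objective I xs =
     Max ((\<lambda>i. \<Sum>j\<in>fun_ids I. weight I i j * real (cov (fn I i j) xs)) ` agents I)"

definition OPT :: "srma \<Rightarrow> real" where
  "OPT I = Min (objective I ` permutations_of_set (ground I))"

definition total_weight :: "srma \<Rightarrow> real" where
  "total_weight I = Max ((\<lambda>i. \<Sum>j\<in>fun_ids I. weight I i j) ` agents I)"

definition nonzero_marginals :: "srma \<Rightarrow> real set" where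
  "nonzero_marginals I =
     {fn I i j S' - fn I i j S | i j S S'.
        i \<in> agents I \<and> j \<in> fun_ids I \<and> S \<subseteq> S' \<and> S' \<subseteq> ground I \<and> fn I i j S < fn I i j S'}"

(* Marginals of a valid instance are at most 1, so inserting 1 does not change the minimum; it only
   fixes the value 1 when no marginal is non-zero, i.e. when every function is constantly 1. *)
definition min_marginal :: "srma \<Rightarrow> real" where
  "min_marginal I = Min (insert 1 (nonzero_marginals I))"

definition unsat :: "srma \<Rightarrow> nat \<Rightarrow> nat set \<Rightarrow> nat set" where
  "unsat I i S = {j \<in> fun_ids I. fn I i j S < 1}"

definition threshold :: "srma \<Rightarrow> nat \<Rightarrow> real" where
  "threshold I p = (2 / 3) ^ p * total_weight I"

definition heavy :: "srma \<Rightarrow> nat \<Rightarrow> nat set \<Rightarrow> nat set" where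
  "heavy I p S = {i \<in> agents I. (\<Sum>j\<in>unsat I i S. weight I i j) > threshold I p}"

definition all_satisfied :: "srma \<Rightarrow> nat set \<Rightarrow> bool" where
  "all_satisfied I S \<longleftrightarrow> (\<forall>i\<in>agents I. unsat I i S = {})"

definition score :: "srma \<Rightarrow> nat set \<Rightarrow> nat set \<Rightarrow> nat \<Rightarrow> real" where
  "score I A' S e =
     (\<Sum>i\<in>A'. \<Sum>j\<in>unsat I i S.
        weight I i j * ((fn I i j (S \<union> {e}) - fn I i j S) / (1 - fn I i j S)))"

definition inner_guard :: "srma \<Rightarrow> nat \<Rightarrow> nat set \<Rightarrow> nat set \<Rightarrow> bool" where
  "inner_guard I p A' S \<longleftrightarrow>
     real (card (heavy I p S)) \<ge> 3 / 4 * real (card A') \<and> heavy I p S \<noteq> {}"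

(* bag_config I p a xs: a run of Balanced Adaptive Greedy can be in outer iteration p with the
   elements xs selected so far, in this order; a is Some A' inside an inner iteration with fixed
   agent set A', and None between inner iterations.  The current time t is length xs + 1. *)
inductive bag_config :: "srma \<Rightarrow> nat \<Rightarrow> nat set option \<Rightarrow> nat list \<Rightarrow> bool" for I where
  init: "bag_config I 1 None []"
| begin_inner:
    "\<lbrakk>bag_config I p None xs; heavy I p (set xs) \<noteq> {}\<rbrakk>
      \<Longrightarrow> bag_config I p (Some (heavy I p (set xs))) xs"
| select:
    "\<lbrakk>bag_config I p (Some A') xs; inner_guard I p A' (set xs);
      is_arg_max (score I A' (set xs)) (\<lambda>e. e \<in> ground I - set xs) e\<rbrakk>
      \<Longrightarrow> bag_config I p (Some A') (xs @ [e])"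
| end_inner:
    "\<lbrakk>bag_config I p (Some A') xs; \<not> inner_guard I p A' (set xs)\<rbrakk>
      \<Longrightarrow> bag_config I p None xs"
| next_outer:
    "\<lbrakk>bag_config I p None xs; heavy I p (set xs) = {}; \<not> all_satisfied I (set xs)\<rbrakk>
      \<Longrightarrow> bag_config I (Suc p) None xs"

definition bag_output :: "srma \<Rightarrow> nat list \<Rightarrow> bool" where
  "bag_output I \<pi> \<longleftrightarrow>
     \<pi> \<in> permutations_of_set (ground I) \<and>
     (\<exists>p xs ys. bag_config I p None xs \<and> all_satisfied I (set xs) \<and> \<pi> = xs @ ys)"

end

theory Submission
  imports Defs
begin

text \<open>
  Fix an optimal permutation \<open>\<sigma>\<close> and a threshold \<open>B = threshold I p\<close>. By Markov's inequality, at
  time \<open>T = \<lfloor>2 OPT / B\<rfloor>\<close> the weight of the functions of an agent not covered by \<open>\<sigma>\<close> is at most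
  \<open>B/2\<close>, so an agent above the threshold \<open>B\<close> has unsatisfied functions of weight at least \<open>B/2\<close> that
  the first \<open>T\<close> elements of \<open>\<sigma>\<close> would satisfy. Since at least three quarters of the agents in \<open>A'\<close>
  are above the threshold, submodularity shows that each greedy step of an inner iteration has score
  at least \<open>3/8 \<cdot> |A'| B / T\<close>. On the other hand, the scores of an inner iteration sum up to at
  most \<open>(1 + ln (1/\<epsilon>))\<close> times the unsatisfied weight of \<open>A'\<close> at its start, which is at most
  \<open>3/2 \<cdot> |A'| B\<close>. So an inner iteration has \<open>O((1 + ln (1/\<epsilon>)) OPT / B)\<close> steps, in each of which
  an agent has unsatisfied weight at most \<open>3/2 \<cdot> B\<close>. This gives a cost of
  \<open>O((1 + ln (1/\<epsilon>)) OPT)\<close> per inner iteration. There are \<open>O(1 + log k)\<close> inner iterations per outer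
  iteration, and \<open>O(1 + log min {n, W})\<close> outer iterations matter: once the unsatisfied weight is
  below \<open>W / min {n, W}\<close>, the remaining cost is at most \<open>W \<le> OPT\<close>.
\<close>

section \<open>Marginal gains of a submodular function\<close>

text \<open>Induction on \<open>X\<close>: submodularity for \<open>S \<union> X\<close> and
  \<open>S \<union> {x}\<close> shows that the gain of \<open>x\<close> on top of
  \<open>S \<union> X\<close> is at most its gain on top of \<open>S\<close>.\<close>

lemma submodular_union_gain:
  assumes "submodular_on U g" "finite X" "X \<subseteq> U" "S \<subseteq> U"
  assumes mono: "mono_on (Pow U) g"
  shows "g (S \<union> X) - g S \<le> (\<Sum>e\<in>X. g (S \<union> {e}) - g S)"
  using assms(2,3)
proof (induction X rule: finite_induct)
  case empty
  then show ?case by simp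
next
  case (insert x X)
  let ?A = "S \<union> X" and ?B = "S \<union> {x}"
  have "g (?A \<union> ?B) + g (?A \<inter> ?B) \<le> g ?A + g ?B"
    using insert.prems \<open>S \<subseteq> U\<close>
    by (intro assms(1)[unfolded submodular_on_def, rule_format]) auto
  moreover have "?A \<union> ?B = S \<union> insert x X" by auto
  moreover have "g S \<le> g (?A \<inter> ?B)"
    by (rule mono_onD[OF mono]) (use insert.prems \<open>S \<subseteq> U\<close> in auto)
  ultimately show ?case using insert by auto
qed

section \<open>Basic facts about a valid instance\<close>

locale valid_srma =
  fixes I :: srma
  assumes valid: "valid_instance I"
begin

abbreviation unsat_weight :: "nat \<Rightarrow> nat set \<Rightarrow> real" where
  "unsat_weight i S \<equiv> \<Sum>j\<in>unsat I i S. weight I i j"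

lemma finite_sets [simp]: "finite (ground I)" "finite (agents I)" "finite (fun_ids I)"
    "finite (unsat I i S)"
  by (auto simp: ground_def agents_def fun_ids_def unsat_def)

lemma sizes: "1 \<le> num_elems I" "1 \<le> num_agents I" "1 \<le> num_funs I"
  using valid by (auto simp: valid_instance_def)

lemma nonempty [simp]: "agents I \<noteq> {}" "fun_ids I \<noteq> {}"
  using sizes by (auto simp: agents_def fun_ids_def)

lemma card_sets: "card (ground I) = num_elems I" "card (agents I) = num_agents I"
  by (auto simp: ground_def agents_def)

lemma
  assumes "i \<in> agents I" "j \<in> fun_ids I"
  shows fn_mono_on: "mono_on (Pow (ground I)) (fn I i j)"
    and fn_submodular: "submodular_on (ground I) (fn I i j)"
    and fn_ground: "fn I i j (ground I) = 1"
    and weight_ge_1: "1 \<le> weight I i j"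
    and fn_le_1: "S \<subseteq> ground I \<Longrightarrow> fn I i j S \<le> 1"
    and fn_ge_0: "S \<subseteq> ground I \<Longrightarrow> 0 \<le> fn I i j S"
  using valid assms by (auto simp: valid_instance_def Pi_def)

lemma fn_mono:
  assumes "i \<in> agents I" "j \<in> fun_ids I" "S \<subseteq> T" "T \<subseteq> ground I"
  shows "fn I i j S \<le> fn I i j T"
  by (rule mono_onD[OF fn_mono_on]) (use assms in auto)

lemma unsat_antimono:
  assumes "i \<in> agents I" "S \<subseteq> T" "T \<subseteq> ground I"
  shows "unsat I i T \<subseteq> unsat I i S"
  using fn_mono[OF assms(1) _ assms(2,3)] by (fastforce simp: unsat_def)

lemma unsat_weight_antimono:
  assumes "i \<in> agents I" "S \<subseteq> T" "T \<subseteq> ground I"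
  shows "unsat_weight i T \<le> unsat_weight i S"
proof (rule sum_mono2)
  show "unsat I i T \<subseteq> unsat I i S" by (rule unsat_antimono[OF assms])
  fix j assume "j \<in> unsat I i S - unsat I i T"
  then have "j \<in> fun_ids I" by (auto simp: unsat_def)
  then show "0 \<le> weight I i j" using weight_ge_1[OF assms(1)] by force
qed simp

lemma weight_sum_le_total:
  "i \<in> agents I \<Longrightarrow> (\<Sum>j\<in>fun_ids I. weight I i j) \<le> total_weight I"
  unfolding total_weight_def by (rule Max_ge) auto

lemma unsat_weight_le_total:
  assumes "i \<in> agents I"
  shows "unsat_weight i S \<le> total_weight I"
proof -
  have "unsat_weight i S \<le> (\<Sum>j\<in>fun_ids I. weight I i j)"
    by (rule sum_mono2) (use weight_ge_1[OF assms] in \<open>force simp: unsat_def\<close>)+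
  then show ?thesis using weight_sum_le_total[OF assms] by linarith
qed

lemma total_weight_ge_1: "1 \<le> total_weight I"
proof -
  obtain i where i: "i \<in> agents I" using nonempty by blast
  obtain j where j: "j \<in> fun_ids I" using nonempty by blast
  have "weight I i j \<le> (\<Sum>j\<in>fun_ids I. weight I i j)"
    by (rule member_le_sum) (use j weight_ge_1[OF i] in force)+
  then show ?thesis using weight_ge_1[OF i j] weight_sum_le_total[OF i] by linarith
qed

lemma threshold_pos: "0 < threshold I p"
  using total_weight_ge_1 by (simp add: threshold_def)

lemma threshold_le_total: "threshold I p \<le> total_weight I"
  unfolding threshold_def using total_weight_ge_1
  by (intro mult_left_le_one_le) (auto simp: power_le_one)

lemma threshold_Suc: "threshold I p = 3 / 2 * threshold I (Suc p)"
  by (simp add: threshold_def)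

lemma heavy_antimono:
  assumes "S \<subseteq> T" "T \<subseteq> ground I"
  shows "heavy I p T \<subseteq> heavy I p S"
  using unsat_weight_antimono[OF _ assms] by (force simp: heavy_def)

lemma finite_heavy [simp]: "finite (heavy I p S)"
  by (auto simp: heavy_def)

lemma finite_nonzero_marginals: "finite (nonzero_marginals I)"
proof -
  have "nonzero_marginals I \<subseteq> (\<lambda>(i, j, S, S'). fn I i j S' - fn I i j S) `
      (agents I \<times> fun_ids I \<times> Pow (ground I) \<times> Pow (ground I))"
  proof
    fix x assume "x \<in> nonzero_marginals I"
    then obtain i j S S' where "x = fn I i j S' - fn I i j S" "i \<in> agents I" "j \<in> fun_ids I"
      "S \<subseteq> S'" "S' \<subseteq> ground I" unfolding nonzero_marginals_def by blast
    then show "x \<in> (\<lambda>(i, j, S, S'). fn I i j S' - fn I i j S) `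
      (agents I \<times> fun_ids I \<times> Pow (ground I) \<times> Pow (ground I))"
      by (intro image_eqI[of _ _ "(i, j, S, S')"]) auto
  qed
  then show ?thesis by (rule finite_subset) simp
qed

lemma min_marginal_le_1: "min_marginal I \<le> 1"
  unfolding min_marginal_def by (rule Min_le) (simp_all add: finite_nonzero_marginals)

lemma min_marginal_pos: "0 < min_marginal I"
proof -
  have "min_marginal I \<in> insert 1 (nonzero_marginals I)"
    unfolding min_marginal_def by (rule Min_in) (simp_all add: finite_nonzero_marginals)
  then show ?thesis by (auto simp: nonzero_marginals_def)
qed

text \<open>The deficit \<open>1 - fn I i j S\<close> is itself a non-zero marginal, namely from
  \<open>S\<close> to the whole ground set. Hence the logarithm in \<open>pot\<close> below is never
  negative on attained values.\<close>

lemma min_marginal_le_deficit: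
  assumes "i \<in> agents I" "j \<in> fun_ids I" "S \<subseteq> ground I" "fn I i j S < 1"
  shows "min_marginal I \<le> 1 - fn I i j S"
  unfolding min_marginal_def
proof (rule Min_le)
  have "fn I i j (ground I) - fn I i j S \<in> nonzero_marginals I"
    unfolding nonzero_marginals_def mem_Collect_eq
    using assms fn_ground[OF assms(1,2)]
    by (intro exI[of _ i] exI[of _ j] exI[of _ S] exI[of _ "ground I"]) simp
  then show "1 - fn I i j S \<in> insert 1 (nonzero_marginals I)"
    using fn_ground[OF assms(1,2)] by simp
qed (simp add: finite_nonzero_marginals)

section \<open>A logarithmic potential for the greedy scores\<close>

text \<open>The logarithm pays for relative gains that leave a function unsatisfied; the summand 1
  pays for the last gain, which closes the whole deficit.\<close>

definition pot :: "real \<Rightarrow> real" where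
  "pot x = (if x < 1 then 1 + ln ((1 - x) / min_marginal I) else 0)"

text \<open>An upper bound on the total score that can still be collected for the agents in \<open>A'\<close>.\<close>
definition potential :: "nat set \<Rightarrow> nat set \<Rightarrow> real" where
  "potential A' S = (\<Sum>i\<in>A'. \<Sum>j\<in>unsat I i S. weight I i j * pot (fn I i j S))"

lemma pot_nonneg:
  assumes "i \<in> agents I" "j \<in> fun_ids I" "S \<subseteq> ground I"
  shows "0 \<le> pot (fn I i j S)"
  using min_marginal_le_deficit[OF assms] min_marginal_pos by (auto simp: pot_def)

lemma pot_le:
  assumes "0 \<le> x"
  shows "pot x \<le> 1 + ln (1 / min_marginal I)"
proof -
  have "ln ((1 - x) / min_marginal I) \<le> ln (1 / min_marginal I)" if "x < 1"
    using assms that min_marginal_pos by (intro ln_mono) (auto simp: divide_right_mono)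
  moreover have "0 \<le> ln (1 / min_marginal I)"
    using min_marginal_pos min_marginal_le_1 by simp
  ultimately show ?thesis by (auto simp: pot_def)
qed

text \<open>For deficits \<open>?x\<close> before and \<open>?y > 0\<close> after, the relative gain
  is \<open>1 - ?y / ?x \<le> - ln (?y / ?x)\<close>. If the function becomes satisfied, the gain is
  1 and the potential drops by at least 1, since the deficit was at least
  \<open>min_marginal I\<close>.\<close>

lemma pot_decrease:
  assumes "i \<in> agents I" "j \<in> fun_ids I" "S \<subseteq> T" "T \<subseteq> ground I" "fn I i j S < 1"
  shows "(fn I i j T - fn I i j S) / (1 - fn I i j S) \<le> pot (fn I i j S) - pot (fn I i j T)"
proof (cases "fn I i j T < 1")
  case True
  let ?x = "1 - fn I i j S" and ?y = "1 - fn I i j T"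
  have pos: "0 < ?x" "0 < ?y" "0 < min_marginal I"
    using assms True min_marginal_pos by auto
  have "ln (?y / ?x) \<le> ?y / ?x - 1"
    using pos by (intro ln_le_minus_one) simp
  moreover have "(fn I i j T - fn I i j S) / ?x = 1 - ?y / ?x"
    using pos by (simp add: field_simps)
  moreover have "pot (fn I i j S) - pot (fn I i j T) = - ln (?y / ?x)"
    using pos True assms(5) by (simp add: pot_def ln_div)
  ultimately show ?thesis by linarith
next
  case False
  then have T: "fn I i j T = 1" using fn_le_1[OF assms(1,2,4)] by simp
  have "min_marginal I \<le> 1 - fn I i j S"
    using min_marginal_le_deficit assms by blast
  then have "0 \<le> ln ((1 - fn I i j S) / min_marginal I)"
    using min_marginal_pos by simp
  then show ?thesis using T assms(5) by (simp add: pot_def)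
qed

lemma potential_nonneg:
  assumes "A' \<subseteq> agents I" "S \<subseteq> ground I"
  shows "0 \<le> potential A' S"
  unfolding potential_def
proof (intro sum_nonneg mult_nonneg_nonneg)
  fix i j assume "i \<in> A'" "j \<in> unsat I i S"
  then have ij: "i \<in> agents I" "j \<in> fun_ids I" using assms by (auto simp: unsat_def)
  show "0 \<le> weight I i j" using weight_ge_1[OF ij] by linarith
  show "0 \<le> pot (fn I i j S)" by (rule pot_nonneg[OF ij assms(2)])
qed

lemma potential_le:
  assumes "A' \<subseteq> agents I" "S \<subseteq> ground I" "\<And>i. i \<in> A' \<Longrightarrow> unsat_weight i S \<le> b"
  shows "potential A' S \<le> real (card A') * b * (1 + ln (1 / min_marginal I))"
proof -
  let ?L = "1 + ln (1 / min_marginal I)"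
  have L: "0 \<le> ?L" using min_marginal_pos min_marginal_le_1 by simp
  have "potential A' S \<le> (\<Sum>i\<in>A'. b * ?L)"
    unfolding potential_def
  proof (rule sum_mono)
    fix i assume i: "i \<in> A'"
    then have ia: "i \<in> agents I" using assms by auto
    have "(\<Sum>j\<in>unsat I i S. weight I i j * pot (fn I i j S)) \<le> (\<Sum>j\<in>unsat I i S. weight I i j * ?L)"
    proof (rule sum_mono)
      fix j assume "j \<in> unsat I i S"
      then have j: "j \<in> fun_ids I" by (auto simp: unsat_def)
      show "weight I i j * pot (fn I i j S) \<le> weight I i j * ?L"
        using weight_ge_1[OF ia j] pot_le[OF fn_ge_0[OF ia j assms(2)]]
        by (intro mult_left_mono) auto
    qed
    also have "\<dots> = unsat_weight i S * ?L" by (simp only: sum_distrib_right)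
    also have "\<dots> \<le> b * ?L" using assms(3)[OF i] L by (rule mult_right_mono)
    finally show "(\<Sum>j\<in>unsat I i S. weight I i j * pot (fn I i j S)) \<le> b * ?L" .
  qed
  then show ?thesis by simp
qed

lemma score_le_potential_decrease:
  assumes "A' \<subseteq> agents I" "S \<subseteq> ground I" "e \<in> ground I"
  shows "score I A' S e \<le> potential A' S - potential A' (S \<union> {e})"
proof -
  let ?T = "S \<union> {e}"
  have T: "?T \<subseteq> ground I" using assms by auto
  have "score I A' S e \<le> (\<Sum>i\<in>A'. \<Sum>j\<in>unsat I i S.
      weight I i j * (pot (fn I i j S) - pot (fn I i j ?T)))"
    unfolding score_def
  proof (intro sum_mono mult_left_mono)
    fix i j assume "i \<in> A'" "j \<in> unsat I i S"
    then have ij: "i \<in> agents I" "j \<in> fun_ids I" "fn I i j S < 1"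
      using assms by (auto simp: unsat_def)
    show "0 \<le> weight I i j" using weight_ge_1[OF ij(1,2)] by linarith
    show "(fn I i j ?T - fn I i j S) / (1 - fn I i j S) \<le> pot (fn I i j S) - pot (fn I i j ?T)"
      by (rule pot_decrease) (use ij T in auto)
  qed
  also have "\<dots> = potential A' S - (\<Sum>i\<in>A'. \<Sum>j\<in>unsat I i S. weight I i j * pot (fn I i j ?T))"
    by (simp add: potential_def right_diff_distrib sum_subtractf)
  also have "(\<Sum>i\<in>A'. \<Sum>j\<in>unsat I i S. weight I i j * pot (fn I i j ?T)) = potential A' ?T"
    unfolding potential_def
  proof (rule sum.cong[OF refl])
    fix i assume "i \<in> A'"
    then have i: "i \<in> agents I" using assms by auto
    show "(\<Sum>j\<in>unsat I i S. weight I i j * pot (fn I i j ?T)) =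
        (\<Sum>j\<in>unsat I i ?T. weight I i j * pot (fn I i j ?T))"
    proof (rule sum.mono_neutral_right)
      show "unsat I i ?T \<subseteq> unsat I i S" by (rule unsat_antimono[OF i _ T]) auto
    qed (auto simp: unsat_def pot_def)
  qed
  finally show ?thesis .
qed

lemma score_nonneg:
  assumes "A' \<subseteq> agents I" "S \<subseteq> ground I" "e \<in> ground I"
  shows "0 \<le> score I A' S e"
  unfolding score_def
proof (intro sum_nonneg mult_nonneg_nonneg divide_nonneg_nonneg)
  fix i j assume "i \<in> A'" "j \<in> unsat I i S"
  then have ij: "i \<in> agents I" "j \<in> fun_ids I" "fn I i j S < 1"
    using assms by (auto simp: unsat_def)
  show "0 \<le> weight I i j" using weight_ge_1[OF ij(1,2)] by linarith
  show "0 \<le> fn I i j (S \<union> {e}) - fn I i j S"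
    using fn_mono[OF ij(1,2), of S "S \<union> {e}"] assms by auto
  show "0 \<le> 1 - fn I i j S" using ij by simp
qed

section \<open>Cover times along a fixed permutation\<close>

context
  fixes \<sigma> :: "nat list"
  assumes perm: "\<sigma> \<in> permutations_of_set (ground I)"
begin

lemma perm_facts: "set \<sigma> = ground I" "length \<sigma> = num_elems I" "\<sigma> \<noteq> []"
  using perm sizes card_sets(1)
  by (auto simp: permutations_of_set_def distinct_card[symmetric])

lemma set_take_perm: "set (take t \<sigma>) \<subseteq> ground I"
  using perm_facts set_take_subset by fast

lemma
  assumes ij: "i \<in> agents I" "j \<in> fun_ids I"
  shows cov_range: "cov (fn I i j) \<sigma> \<in> {1..num_elems I}"
    and fn_take_cov: "fn I i j (set (take (cov (fn I i j) \<sigma>) \<sigma>)) = 1"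
proof -
  let ?P = "\<lambda>t. t \<in> {1..length \<sigma>} \<and> fn I i j (set (take t \<sigma>)) = 1"
  have "?P (num_elems I)" using sizes perm_facts fn_ground[OF ij] by simp
  then have "?P (LEAST t. ?P t)" by (rule LeastI)
  then show "cov (fn I i j) \<sigma> \<in> {1..num_elems I}"
      "fn I i j (set (take (cov (fn I i j) \<sigma>) \<sigma>)) = 1"
    using perm_facts by (auto simp: cov_def)
qed

text \<open>By monotonicity the value stays 1 once it is reached. The case \<open>t = 0\<close> is
  excluded because a function may be 1 on the empty set, while its cover time is still 1.\<close>

lemma cov_le_iff:
  assumes ij: "i \<in> agents I" "j \<in> fun_ids I" and "1 \<le> t"
  shows "cov (fn I i j) \<sigma> \<le> t \<longleftrightarrow> fn I i j (set (take t \<sigma>)) = 1"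
proof
  assume "cov (fn I i j) \<sigma> \<le> t"
  then have "fn I i j (set (take (cov (fn I i j) \<sigma>) \<sigma>)) \<le> fn I i j (set (take t \<sigma>))"
    by (intro fn_mono ij set_take_subset_set_take set_take_perm)
  then show "fn I i j (set (take t \<sigma>)) = 1"
    using fn_take_cov[OF ij] fn_le_1[OF ij set_take_perm[of t]] by linarith
next
  assume t: "fn I i j (set (take t \<sigma>)) = 1"
  show "cov (fn I i j) \<sigma> \<le> t"
  proof (cases "t \<le> num_elems I")
    case True
    then show ?thesis unfolding cov_def
      by (intro Least_le) (use t \<open>1 \<le> t\<close> perm_facts in auto)
  next
    case False
    then show ?thesis using cov_range[OF ij] by auto
  qed
qed

lemma agent_cost_le_objective:
  assumes "i \<in> agents I"
  shows "(\<Sum>j\<in>fun_ids I. weight I i j * real (cov (fn I i j) \<sigma>)) \<le> objective I \<sigma>"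
  unfolding objective_def by (rule Max_ge) (use assms in auto)

text \<open>Every cover time is at least 1. This later absorbs additive errors of size
  \<open>total_weight I\<close> into the optimum.\<close>

lemma total_weight_le_objective: "total_weight I \<le> objective I \<sigma>"
proof -
  have "(\<Sum>j\<in>fun_ids I. weight I i j) \<le> objective I \<sigma>" if i: "i \<in> agents I" for i
  proof -
    have "(\<Sum>j\<in>fun_ids I. weight I i j) \<le> (\<Sum>j\<in>fun_ids I. weight I i j * real (cov (fn I i j) \<sigma>))"
    proof (rule sum_mono)
      fix j assume j: "j \<in> fun_ids I"
      have "weight I i j * 1 \<le> weight I i j * real (cov (fn I i j) \<sigma>)"
        using weight_ge_1[OF i j] cov_range[OF i j] by (intro mult_left_mono) auto
      then show "weight I i j \<le> weight I i j * real (cov (fn I i j) \<sigma>)" by simp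
    qed
    then show ?thesis using agent_cost_le_objective[OF i] by linarith
  qed
  then show ?thesis unfolding total_weight_def by (subst Max_le_iff) auto
qed

text \<open>Markov's inequality. Cover times are integers, so late means at least
  \<open>T + 1\<close>; this is what allows \<open>T\<close> to be a rounded-down quotient.\<close>

lemma weight_covered_late:
  assumes i: "i \<in> agents I" and "J \<subseteq> fun_ids I" and late: "\<And>j. j \<in> J \<Longrightarrow> T < cov (fn I i j) \<sigma>"
  shows "(\<Sum>j\<in>J. weight I i j) * (real T + 1) \<le> objective I \<sigma>"
proof -
  have "(\<Sum>j\<in>J. weight I i j) * (real T + 1) = (\<Sum>j\<in>J. weight I i j * (real T + 1))"
    by (simp only: sum_distrib_right)
  also have "\<dots> \<le> (\<Sum>j\<in>J. weight I i j * real (cov (fn I i j) \<sigma>))"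
  proof (intro sum_mono mult_left_mono)
    fix j assume j: "j \<in> J"
    show "real T + 1 \<le> real (cov (fn I i j) \<sigma>)" using late[OF j] by linarith
    show "0 \<le> weight I i j" using weight_ge_1[OF i, of j] j assms(2) by force
  qed
  also have "\<dots> \<le> (\<Sum>j\<in>fun_ids I. weight I i j * real (cov (fn I i j) \<sigma>))"
    by (rule sum_mono2) (use assms(2) weight_ge_1[OF i] in force)+
  also have "\<dots> \<le> objective I \<sigma>" by (rule agent_cost_le_objective[OF i])
  finally show ?thesis .
qed

section \<open>Greedy steps compared with a prefix of the fixed permutation\<close>

text \<open>Functions covered after \<open>T\<close> weigh less than \<open>B / 2\<close>, so at
  least \<open>B / 2\<close> of the unsatisfied weight is covered by the prefix. The prefix closes
  the whole deficit of each such function, so by submodularity the relative gains of its elements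
  sum to at least 1.\<close>

lemma prefix_gain:
  assumes i: "i \<in> agents I" and S: "S \<subseteq> ground I" and "B > 0" and B: "B < unsat_weight i S"
    and T: "2 * objective I \<sigma> < B * (real T + 1)" "1 \<le> T"
  shows "B / 2 \<le> (\<Sum>e\<in>set (take T \<sigma>). \<Sum>j\<in>unsat I i S.
      weight I i j * ((fn I i j (S \<union> {e}) - fn I i j S) / (1 - fn I i j S)))"
proof -
  let ?X = "set (take T \<sigma>)"
  let ?J = "{j \<in> unsat I i S. cov (fn I i j) \<sigma> \<le> T}"
  let ?J' = "{j \<in> unsat I i S. T < cov (fn I i j) \<sigma>}"
  have "(\<Sum>j\<in>?J'. weight I i j) * (real T + 1) \<le> objective I \<sigma>"
    by (rule weight_covered_late[OF i]) (auto simp: unsat_def)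
  with T have "(\<Sum>j\<in>?J'. weight I i j) * (real T + 1) < B / 2 * (real T + 1)"
    by linarith
  then have "(\<Sum>j\<in>?J'. weight I i j) < B / 2" by (simp add: mult_less_cancel_right)
  moreover have "unsat_weight i S = (\<Sum>j\<in>?J. weight I i j) + (\<Sum>j\<in>?J'. weight I i j)"
    by (subst sum.union_disjoint[symmetric]) (auto intro!: sum.cong)
  ultimately have "B / 2 \<le> (\<Sum>j\<in>?J. weight I i j)" using B by linarith
  also have "\<dots> \<le> (\<Sum>j\<in>unsat I i S. weight I i j *
      ((\<Sum>e\<in>?X. fn I i j (S \<union> {e}) - fn I i j S) / (1 - fn I i j S)))"
  proof (rule sum_le_included[where i = "\<lambda>j. j"])
    show "\<forall>j\<in>?J. \<exists>j'\<in>unsat I i S. j' = j \<and> weight I i j \<le> weight I i j' *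
      ((\<Sum>e\<in>?X. fn I i j' (S \<union> {e}) - fn I i j' S) / (1 - fn I i j' S))"
    proof
      fix j assume J: "j \<in> ?J"
      then have j: "j \<in> fun_ids I" "fn I i j S < 1" by (auto simp: unsat_def)
      have "fn I i j ?X = 1" using J cov_le_iff[OF i j(1) T(2)] by auto
      moreover have "fn I i j ?X \<le> fn I i j (S \<union> ?X)"
        by (rule fn_mono[OF i j(1)]) (use S set_take_perm in auto)
      moreover have "fn I i j (S \<union> ?X) - fn I i j S \<le> (\<Sum>e\<in>?X. fn I i j (S \<union> {e}) - fn I i j S)"
        by (rule submodular_union_gain[OF fn_submodular[OF i j(1)]])
          (use S set_take_perm fn_mono_on[OF i j(1)] in auto)
      ultimately have "1 \<le> (\<Sum>e\<in>?X. fn I i j (S \<union> {e}) - fn I i j S) / (1 - fn I i j S)"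
        by (subst le_divide_eq_1_pos) (use j(2) in linarith)+
      then have "weight I i j * 1 \<le>
          weight I i j * ((\<Sum>e\<in>?X. fn I i j (S \<union> {e}) - fn I i j S) / (1 - fn I i j S))"
        using weight_ge_1[OF i j(1)] by (intro mult_left_mono) auto
      then show "\<exists>j'\<in>unsat I i S. j' = j \<and> weight I i j \<le> weight I i j' *
          ((\<Sum>e\<in>?X. fn I i j' (S \<union> {e}) - fn I i j' S) / (1 - fn I i j' S))"
        using J by auto
    qed
    show "\<forall>j\<in>unsat I i S. 0 \<le> weight I i j *
        ((\<Sum>e\<in>?X. fn I i j (S \<union> {e}) - fn I i j S) / (1 - fn I i j S))"
    proof (intro ballI mult_nonneg_nonneg divide_nonneg_nonneg sum_nonneg)
      fix j assume "j \<in> unsat I i S"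
      then have j: "j \<in> fun_ids I" "fn I i j S < 1" by (auto simp: unsat_def)
      show "0 \<le> weight I i j" using weight_ge_1[OF i j(1)] by linarith
      show "0 \<le> 1 - fn I i j S" using j by simp
      fix e assume "e \<in> ?X"
      then show "0 \<le> fn I i j (S \<union> {e}) - fn I i j S"
        using fn_mono[OF i j(1), of S "S \<union> {e}"] S set_take_perm by auto
    qed
  qed simp_all
  also have "\<dots> = (\<Sum>e\<in>?X. \<Sum>j\<in>unsat I i S.
      weight I i j * ((fn I i j (S \<union> {e}) - fn I i j S) / (1 - fn I i j S)))"
    by (subst sum.swap) (simp add: sum_divide_distrib sum_distrib_left)
  finally show ?thesis .
qed

text \<open>Averaging: the scores of the \<open>T\<close> prefix elements sum to at least
  \<open>3/4 * |A'| * B/2\<close>, and the greedy choice is at least as good as each of them. With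
  \<open>T \<le> 2 * Obj / B\<close> the constant becomes \<open>3/8 * 1/2 = 3/16\<close>; the bound
  is stated without division.\<close>

lemma greedy_score:
  assumes A': "A' \<subseteq> agents I" "heavy I p S \<subseteq> A'" and S: "S \<subseteq> ground I"
    and guard: "inner_guard I p A' S"
    and e: "is_arg_max (score I A' S) (\<lambda>e. e \<in> ground I - S) e"
  shows "3 / 16 * real (card A') * (threshold I p)\<^sup>2 \<le> objective I \<sigma> * score I A' S e"
proof -
  let ?B = "threshold I p" and ?Obj = "objective I \<sigma>"
  define T where "T = nat \<lfloor>2 * ?Obj / ?B\<rfloor>"
  let ?X = "set (take T \<sigma>)"
  let ?h = "\<lambda>i e. \<Sum>j\<in>unsat I i S.
      weight I i j * ((fn I i j (S \<union> {e}) - fn I i j S) / (1 - fn I i j S))"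
  note B = threshold_pos[of p]
  have BO: "?B \<le> ?Obj" using threshold_le_total total_weight_le_objective by (rule order_trans)
  \<comment> \<open>Ensures that the rounded-down \<open>T\<close> is at least 1, as
    \<open>prefix_gain\<close> requires.\<close>
  have q: "1 \<le> 2 * ?Obj / ?B" using B BO by simp
  have T: "real T \<le> 2 * ?Obj / ?B" "2 * ?Obj / ?B < real T + 1" "1 \<le> T"
    using q unfolding T_def by linarith+
  have e': "e \<in> ground I" "\<And>e'. e' \<in> ground I - S \<Longrightarrow> score I A' S e' \<le> score I A' S e"
    using e by (auto simp: is_arg_max_def not_less)
  have nonneg: "0 \<le> score I A' S e" by (rule score_nonneg[OF A'(1) S e'(1)])
  have finA: "finite A'" by (rule finite_subset[OF A'(1)]) simp
  \<comment> \<open>The greedy maximum ranges over unselected elements only; prefix elements already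
    in \<open>S\<close> have score 0.\<close>
  have le: "score I A' S x \<le> score I A' S e" if "x \<in> ?X" for x
  proof (cases "x \<in> S")
    case True
    then have "S \<union> {x} = S" by auto
    then show ?thesis using nonneg by (simp add: score_def)
  next
    case False
    then show ?thesis using e'(2) that set_take_perm by blast
  qed
  have "3 / 8 * real (card A') * ?B \<le> real (card (heavy I p S)) * (?B / 2)"
    using guard B by (simp add: inner_guard_def)
  also have "\<dots> = (\<Sum>i\<in>heavy I p S. ?B / 2)" by simp
  also have "\<dots> \<le> (\<Sum>i\<in>heavy I p S. \<Sum>x\<in>?X. ?h i x)"
  proof (rule sum_mono)
    fix i assume "i \<in> heavy I p S"
    then have i: "i \<in> agents I" "?B < unsat_weight i S" by (auto simp: heavy_def)
    show "?B / 2 \<le> (\<Sum>x\<in>?X. ?h i x)"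
      by (rule prefix_gain[OF i(1) S B i(2) _ T(3)]) (use T(2) B in \<open>simp add: field_simps\<close>)
  qed
  also have "\<dots> \<le> (\<Sum>i\<in>A'. \<Sum>x\<in>?X. ?h i x)"
  proof (rule sum_mono2[OF finA A'(2)])
    fix i assume "i \<in> A' - heavy I p S"
    show "0 \<le> (\<Sum>x\<in>?X. ?h i x)"
    proof (rule sum_nonneg)
      fix x assume "x \<in> ?X"
      \<comment> \<open>\<open>?h i x\<close> is the score for the single agent
        \<open>i\<close>.\<close>
      then have "0 \<le> score I {i} S x"
        using \<open>i \<in> A' - heavy I p S\<close> A'(1) set_take_perm by (intro score_nonneg S) auto
      then show "0 \<le> ?h i x" by (simp add: score_def)
    qed
  qed
  also have "\<dots> = (\<Sum>x\<in>?X. score I A' S x)"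
    unfolding score_def by (rule sum.swap)
  also have "\<dots> \<le> real (card ?X) * score I A' S e"
    using le by (rule sum_bounded_above)
  also have "\<dots> \<le> real T * score I A' S e"
    using card_length[of "take T \<sigma>"] nonneg by (intro mult_right_mono) auto
  also have "\<dots> \<le> 2 * ?Obj / ?B * score I A' S e"
    using T(1) nonneg by (rule mult_right_mono)
  finally show ?thesis using B by (simp add: field_simps power2_eq_square)
qed

end

section \<open>Cost accounting along a run of the algorithm\<close>

lemma bag_config_basic:
  assumes "bag_config I p a xs"
  shows "1 \<le> p \<and> set xs \<subseteq> ground I"
  using assms by induction (auto simp: is_arg_max_def)

definition log_factor :: real where
  "log_factor = 1 + ln (1 / min_marginal I)"

definition cutoff :: real where
  "cutoff = min (real (num_elems I)) (total_weight I)"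

text \<open>Cost is charged per time step: each step pays the weight still unsatisfied before it.
  Steps with weight below \<open>total_weight I / cutoff\<close> are dropped here and accounted for
  in \<open>cost_le_big_cost\<close>.\<close>

definition big_cost :: "nat \<Rightarrow> nat list \<Rightarrow> real" where
  "big_cost i xs = (\<Sum>t<length xs.
     if total_weight I \<le> cutoff * unsat_weight i (set (take t xs))
     then unsat_weight i (set (take t xs)) else 0)"

text \<open>Outer iteration \<open>Suc p\<close> starts with unsatisfied weights at most \<open>threshold I p\<close>, so only the
  counted outer iterations contribute to \<open>big_cost\<close>.\<close>
definition big_iterations :: "nat \<Rightarrow> nat" where
  "big_iterations p = card {p'. p' < p \<and> 1 \<le> cutoff * (2 / 3) ^ p'}"

text \<open>Bounds the number of inner iterations in one outer iteration, as each shrinks the set of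
  heavy agents to at most 3/4 of its size.\<close>

definition inner_bound :: real where
  "inner_bound = 1 + log (4 / 3) (real (num_agents I))"

lemma log_factor_ge_1: "1 \<le> log_factor"
  using min_marginal_pos min_marginal_le_1 by (simp add: log_factor_def)

lemma cutoff_ge_1: "1 \<le> cutoff"
  using sizes total_weight_ge_1 by (simp add: cutoff_def)

lemma inner_bound_ge_1: "1 \<le> inner_bound"
  using sizes by (simp add: inner_bound_def)

lemma big_cost_append:
  "big_cost i (xs @ ys) = big_cost i xs + (\<Sum>t<length ys.
     if total_weight I \<le> cutoff * unsat_weight i (set xs \<union> set (take t ys))
     then unsat_weight i (set xs \<union> set (take t ys)) else 0)"
proof -
  have split: "(\<Sum>t<a + b. f t) = (\<Sum>t<a. f t) + (\<Sum>t<b. f (a + t))" for a b and f :: "nat \<Rightarrow> real"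
    by (induction b) simp_all
  show ?thesis unfolding big_cost_def length_append split
    by (auto simp: take_append intro!: sum.cong arg_cong2[where f = "(+)"])
qed

lemma big_iterations_Suc:
  "big_iterations (Suc p) = big_iterations p + (if 1 \<le> cutoff * (2 / 3) ^ p then 1 else 0)"
proof -
  have "{p'. p' < Suc p \<and> 1 \<le> cutoff * (2 / 3) ^ p'} =
     (if 1 \<le> cutoff * (2 / 3) ^ p then insert p else id) {p'. p' < p \<and> 1 \<le> cutoff * (2 / 3) ^ p'}"
    by (auto simp: less_Suc_eq)
  then show ?thesis by (simp add: big_iterations_def)
qed

text \<open>A counted index satisfies \<open>(3 / 2) ^ p' \<le> cutoff\<close>, so it lies between 0
  and the rounded-down logarithm.\<close>

lemma big_iterations_le: "real (big_iterations p) \<le> 1 + log (3 / 2) cutoff"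
proof -
  have le: "real p' \<le> log (3 / 2) cutoff" if "1 \<le> cutoff * (2 / 3) ^ p'" for p'
  proof -
    have "(3 / 2 :: real) ^ p' * (2 / 3) ^ p' = 1"
      by (simp flip: power_mult_distrib)
    moreover have "(3 / 2 :: real) ^ p' * 1 \<le> (3 / 2) ^ p' * (cutoff * (2 / 3) ^ p')"
      using that by (intro mult_left_mono) auto
    ultimately have "(3 / 2) ^ p' \<le> cutoff" by (simp add: mult.left_commute)
    then show ?thesis using cutoff_ge_1 by (simp add: le_log_iff powr_realpow)
  qed
  have "big_iterations p \<le> card {..nat \<lfloor>log (3 / 2) cutoff\<rfloor>}"
    unfolding big_iterations_def
    by (rule card_mono) (use le in \<open>auto simp: le_nat_floor\<close>)
  moreover have "0 \<le> log (3 / 2) cutoff" using cutoff_ge_1 by simp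
  ultimately show ?thesis by (simp add: nat_le_eq_zle) linarith
qed

text \<open>Here \<open>q\<close> counts the inner iterations completed in outer iteration
  \<open>p\<close>. Earlier outer iterations are charged \<open>D * inner_bound\<close> each and the
  current one \<open>D\<close> per completed inner iteration, but only where counted by
  \<open>big_iterations\<close>. The shift to \<open>p - 1\<close> reflects the bound on the weights
  at the start of the outer iteration.\<close>

definition between_inner :: "real \<Rightarrow> nat \<Rightarrow> nat \<Rightarrow> nat list \<Rightarrow> bool" where
  "between_inner D p q xs \<longleftrightarrow> real q \<le> inner_bound \<and>
     real (card (heavy I p (set xs))) \<le> (3 / 4) ^ q * real (num_agents I) \<and>
     (\<forall>i\<in>agents I. unsat_weight i (set xs) \<le> threshold I (p - 1)) \<and>
     (\<forall>i\<in>agents I. big_cost i xs \<le> D * inner_bound * real (big_iterations (p - 1)) +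
        D * real q * (if 1 \<le> cutoff * (2 / 3) ^ (p - 1) then 1 else 0))"

text \<open>Here \<open>zs\<close> lists the elements selected in the current inner iteration.\<close>
definition inside_inner :: "real \<Rightarrow> nat \<Rightarrow> nat \<Rightarrow> nat set \<Rightarrow> nat list \<Rightarrow> nat list \<Rightarrow> real \<Rightarrow> bool" where
  "inside_inner D p q A' ys zs Obj \<longleftrightarrow> between_inner D p q ys \<and>
     A' = heavy I p (set ys) \<and> A' \<noteq> {} \<and>
     real (length zs) * (3 / 16 * real (card A') * (threshold I p)\<^sup>2)
       \<le> Obj * (potential A' (set ys) - potential A' (set ys \<union> set zs))"

text \<open>As long as a heavy agent remains, \<open>(4 / 3) ^ q \<le> k\<close>, so a further inner
  iteration still fits into the bound.\<close>

lemma inner_index_bound: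
  assumes "real c \<le> (3 / 4) ^ q * real k" "1 \<le> c"
  shows "real q + 1 \<le> 1 + log (4 / 3) (real k)"
proof -
  have "1 \<le> (3 / 4) ^ q * real k" using assms by linarith
  then have "(4 / 3) ^ q * 1 \<le> (4 / 3) ^ q * ((3 / 4) ^ q * real k)"
    by (intro mult_left_mono) auto
  moreover have "(4 / 3 :: real) ^ q * (3 / 4) ^ q = 1"
    by (simp flip: power_mult_distrib)
  ultimately have "(4 / 3) ^ q \<le> real k" by (simp add: mult.assoc[symmetric])
  moreover from this have "0 < real k" by (rule less_le_trans[rotated]) simp
  ultimately show ?thesis by (simp add: le_log_iff powr_realpow)
qed

text \<open>The potential at the start is at most \<open>|A'| * 3/2 B * log_factor\<close>, and each
  step uses at least \<open>3/16 * |A'| * B^2 / Obj\<close> of it. Hence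
  \<open>length zs * B \<le> 8 * log_factor * Obj\<close>; each step costs at most
  \<open>3/2 B\<close>, whence the 12 in \<open>D\<close>.\<close>

lemma inner_cost:
  assumes inside: "inside_inner D p q A' ys zs Obj" and "1 \<le> p" and i: "i \<in> agents I"
    and ground: "set (ys @ zs) \<subseteq> ground I" and "0 \<le> Obj" and D: "D = 12 * log_factor * Obj"
  shows "big_cost i (ys @ zs) \<le> big_cost i ys + D * (if 1 \<le> cutoff * (2 / 3) ^ (p - 1) then 1 else 0)"
proof -
  let ?B = "threshold I p" and ?ind = "if 1 \<le> cutoff * (2 / 3) ^ (p - 1) then 1 else (0 :: real)"
  have B': "threshold I (p - 1) = 3 / 2 * ?B"
    using threshold_Suc[of "p - 1"] \<open>1 \<le> p\<close> by simp
  have B: "0 < ?B" by (rule threshold_pos)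
  have between: "between_inner D p q ys" and A'_def: "A' = heavy I p (set ys)" and "A' \<noteq> {}"
    using inside by (auto simp: inside_inner_def)
  then have sub: "A' \<subseteq> agents I" and card: "0 < real (card A')"
    by (auto simp: heavy_def card_gt_0_iff)
  have start: "unsat_weight i' (set ys) \<le> 3 / 2 * ?B" if "i' \<in> agents I" for i'
    using between that B' by (auto simp: between_inner_def)
  have "potential A' (set ys) \<le> real (card A') * (3 / 2 * ?B) * log_factor"
    unfolding log_factor_def using sub ground start by (intro potential_le) auto
  moreover have "0 \<le> potential A' (set ys \<union> set zs)"
    using sub ground by (intro potential_nonneg) auto
  ultimately have "potential A' (set ys) - potential A' (set ys \<union> set zs)
      \<le> real (card A') * (3 / 2 * ?B) * log_factor" by linarith
  then have "Obj * (potential A' (set ys) - potential A' (set ys \<union> set zs))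
      \<le> Obj * (real (card A') * (3 / 2 * ?B) * log_factor)"
    using \<open>0 \<le> Obj\<close> by (rule mult_left_mono)
  then have "real (length zs) * (3 / 16 * real (card A') * ?B\<^sup>2)
      \<le> Obj * (real (card A') * (3 / 2 * ?B) * log_factor)"
    using inside unfolding inside_inner_def by linarith
  then have "(real (card A') * ?B) * (3 / 16 * (real (length zs) * ?B))
      \<le> (real (card A') * ?B) * (3 / 2 * (log_factor * Obj))"
    by (simp add: power2_eq_square mult_ac)
  then have "3 / 16 * (real (length zs) * ?B) \<le> 3 / 2 * (log_factor * Obj)"
    by (rule mult_left_le_imp_le) (use card B in simp)
  then have len: "real (length zs) * (3 / 2 * ?B) \<le> D" using D by simp
  \<comment> \<open>A charged weight is at least \<open>total_weight I / cutoff\<close> and at most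
    \<open>threshold I (p - 1)\<close>, which forces the current outer iteration to be a counted
    one.\<close>
  have step: "(if total_weight I \<le> cutoff * w then w else 0) \<le> 3 / 2 * ?B * ?ind"
    if "w \<le> 3 / 2 * ?B" for w
  proof (cases "total_weight I \<le> cutoff * w")
    case True
    also have "cutoff * w \<le> cutoff * threshold I (p - 1)"
      using that B' cutoff_ge_1 by (intro mult_left_mono) auto
    finally have "1 * total_weight I \<le> cutoff * (2 / 3) ^ (p - 1) * total_weight I"
      by (simp add: threshold_def mult_ac)
    then have "1 \<le> cutoff * (2 / 3) ^ (p - 1)"
      using total_weight_ge_1 by (subst (asm) mult_le_cancel_right) auto
    then show ?thesis using that B by auto
  next
    case False
    then show ?thesis using B by simp
  qed
  have "(\<Sum>t<length zs. if total_weight I \<le> cutoff * unsat_weight i (set ys \<union> set (take t zs))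
     then unsat_weight i (set ys \<union> set (take t zs)) else 0) \<le> (\<Sum>t<length zs. 3 / 2 * ?B * ?ind)"
  proof (rule sum_mono, rule step)
    fix t
    have "unsat_weight i (set ys \<union> set (take t zs)) \<le> unsat_weight i (set ys)"
      by (rule unsat_weight_antimono[OF i]) (use ground set_take_subset in \<open>force+\<close>)
    then show "unsat_weight i (set ys \<union> set (take t zs)) \<le> 3 / 2 * ?B"
      using start[OF i] by linarith
  qed
  also have "\<dots> = real (length zs) * (3 / 2 * ?B) * ?ind" by simp
  also have "\<dots> \<le> D * ?ind" using len by (rule mult_right_mono) simp
  finally show ?thesis by (simp add: big_cost_append)
qed

section \<open>The invariant of a run\<close>

text \<open>Induction on the run: selecting an element trades its score for potential, ending an
  inner iteration increases \<open>q\<close>, and moving to the next outer iteration resets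
  \<open>q\<close> to 0.\<close>

lemma bag_config_invariant:
  assumes "bag_config I p a xs" and perm: "\<sigma> \<in> permutations_of_set (ground I)"
    and D: "D = 12 * log_factor * objective I \<sigma>"
  shows "case a of
      None \<Rightarrow> \<exists>q. between_inner D p q xs
    | Some A' \<Rightarrow> \<exists>q ys zs. xs = ys @ zs \<and> inside_inner D p q A' ys zs (objective I \<sigma>)"
  using assms(1)
proof induction
  case init
  have "unsat_weight i {} \<le> threshold I 0" if "i \<in> agents I" for i
    using unsat_weight_le_total[OF that] by (simp add: threshold_def)
  moreover have "card (heavy I 1 {}) \<le> num_agents I"
    unfolding card_sets(2)[symmetric] by (rule card_mono) (auto simp: heavy_def)
  ultimately have "between_inner D 1 0 []"
    using inner_bound_ge_1 by (simp add: between_inner_def big_cost_def big_iterations_def)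
  then show ?case by auto
next
  case (begin_inner p xs)
  then obtain q where "between_inner D p q xs" by auto
  then have inside: "inside_inner D p q (heavy I p (set xs)) xs [] (objective I \<sigma>)"
    using begin_inner by (simp add: inside_inner_def)
  show ?case unfolding option.case
    by (rule exI[of _ q], rule exI[of _ xs], rule exI[of _ "[]"]) (simp add: inside)
next
  case (select p A' xs e)
  then obtain q ys zs where xs: "xs = ys @ zs" and inside: "inside_inner D p q A' ys zs (objective I \<sigma>)"
    by auto
  have S: "set xs \<subseteq> ground I" using bag_config_basic[OF select(1)] by simp
  have e: "e \<in> ground I" using select(3) by (auto simp: is_arg_max_def)
  have A': "A' = heavy I p (set ys)" using inside by (simp add: inside_inner_def)
  then have sub: "A' \<subseteq> agents I" by (auto simp: heavy_def)
  \<comment> \<open>Unsatisfied weights only decrease, so no agent becomes heavy during an inner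
    iteration.\<close>
  have "heavy I p (set xs) \<subseteq> A'" unfolding A' by (rule heavy_antimono) (use xs S in auto)
  from greedy_score[OF perm sub this S select(2,3)]
  have "3 / 16 * real (card A') * (threshold I p)\<^sup>2 \<le> objective I \<sigma> * score I A' (set xs) e" .
  also have "\<dots> \<le> objective I \<sigma> * (potential A' (set xs) - potential A' (set xs \<union> {e}))"
    using score_le_potential_decrease[OF sub S e] total_weight_le_objective[OF perm] total_weight_ge_1
    by (intro mult_left_mono) auto
  finally have gain: "3 / 16 * real (card A') * (threshold I p)\<^sup>2 \<le>
      objective I \<sigma> * (potential A' (set ys \<union> set zs) - potential A' (set ys \<union> set (zs @ [e])))"
    by (simp add: xs)
  have "real (length zs) * (3 / 16 * real (card A') * (threshold I p)\<^sup>2) \<le>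
      objective I \<sigma> * (potential A' (set ys) - potential A' (set ys \<union> set zs))"
    using inside unfolding inside_inner_def by blast
  with gain have "real (length (zs @ [e])) * (3 / 16 * real (card A') * (threshold I p)\<^sup>2) \<le>
      objective I \<sigma> * (potential A' (set ys) - potential A' (set ys \<union> set (zs @ [e])))"
    unfolding length_append right_diff_distrib of_nat_add distrib_right by simp
  with inside have "inside_inner D p q A' ys (zs @ [e]) (objective I \<sigma>)"
    unfolding inside_inner_def by blast
  then show ?case unfolding option.case
    using xs append_assoc by blast
next
  case (end_inner p A' xs)
  then obtain q ys zs where xs: "xs = ys @ zs" and inside: "inside_inner D p q A' ys zs (objective I \<sigma>)"
    by auto
  have p: "1 \<le> p" and S: "set xs \<subseteq> ground I" using bag_config_basic[OF end_inner(1)] by auto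
  have A': "A' = heavy I p (set ys)" "A' \<noteq> {}" and between: "between_inner D p q ys"
    using inside by (auto simp: inside_inner_def)
  have card: "real (card A') \<le> (3 / 4) ^ q * real (num_agents I)"
    using between A' by (simp add: between_inner_def)
  have "1 \<le> card A'" using A' by (simp add: Suc_le_eq card_gt_0_iff)
  then have q: "real (Suc q) \<le> inner_bound"
    using inner_index_bound[OF card] by (simp add: inner_bound_def)
  \<comment> \<open>The guard fails either by the 3/4 condition or because no agent is heavy; the
    bound holds in both cases.\<close>
  have "real (card (heavy I p (set xs))) \<le> 3 / 4 * real (card A')"
    using end_inner(2) by (auto simp: inner_guard_def)
  then have heavy: "real (card (heavy I p (set xs))) \<le> (3 / 4) ^ Suc q * real (num_agents I)"
    using card by simp
  have "between_inner D p (Suc q) xs"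
    unfolding between_inner_def
  proof (intro conjI ballI q heavy)
    fix i assume i: "i \<in> agents I"
    have "unsat_weight i (set xs) \<le> unsat_weight i (set ys)"
      by (rule unsat_weight_antimono[OF i]) (use xs S in auto)
    then show "unsat_weight i (set xs) \<le> threshold I (p - 1)"
      using between i unfolding between_inner_def by fastforce
    let ?ind = "if 1 \<le> cutoff * (2 / 3) ^ (p - 1) then 1 else (0 :: real)"
    have "big_cost i xs \<le> big_cost i ys + D * ?ind"
      unfolding xs using S xs total_weight_le_objective[OF perm] total_weight_ge_1
      by (intro inner_cost[OF inside p i _ _ D]) auto
    also have "big_cost i ys \<le>
        D * inner_bound * real (big_iterations (p - 1)) + D * real q * ?ind"
      using between i unfolding between_inner_def by blast
    finally show "big_cost i xs \<le>
        D * inner_bound * real (big_iterations (p - 1)) + D * real (Suc q) * ?ind"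
      by (simp add: algebra_simps split: if_splits)
  qed
  then show ?case by auto
next
  case (next_outer p xs)
  then obtain q where between: "between_inner D p q xs" by auto
  have p: "1 \<le> p" using bag_config_basic[OF next_outer(1)] by auto
  have D0: "0 \<le> D" using D log_factor_ge_1 total_weight_le_objective[OF perm] total_weight_ge_1 by simp
  have "card (heavy I (Suc p) (set xs)) \<le> num_agents I"
    unfolding card_sets(2)[symmetric] by (rule card_mono) (auto simp: heavy_def)
  moreover have "unsat_weight i (set xs) \<le> threshold I p" if "i \<in> agents I" for i
    using next_outer(2) that by (auto simp: heavy_def not_less)
  moreover have "big_cost i xs \<le> D * inner_bound * real (big_iterations p)" if "i \<in> agents I" for i
  proof -
    let ?ind = "if 1 \<le> cutoff * (2 / 3) ^ (p - 1) then 1 else (0 :: real)"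
    have "big_cost i xs \<le> D * inner_bound * real (big_iterations (p - 1)) + D * real q * ?ind"
      using between that unfolding between_inner_def by blast
    \<comment> \<open>The finished outer iteration is now charged in full, which matches the
      increment of \<open>big_iterations\<close>.\<close>
    also have "D * real q * ?ind \<le> D * inner_bound * ?ind"
      using between D0 unfolding between_inner_def by (intro mult_right_mono mult_left_mono) auto
    finally show ?thesis
      using big_iterations_Suc[of "p - 1"] p by (simp add: algebra_simps split: if_splits)
  qed
  ultimately have "between_inner D (Suc p) 0 xs"
    using inner_bound_ge_1 by (simp add: between_inner_def)
  then show ?case by auto
qed

section \<open>From the charged cost to the objective\<close>

lemma big_cost_None:
  assumes "bag_config I p None xs" "\<sigma> \<in> permutations_of_set (ground I)" "i \<in> agents I"
  shows "big_cost i xs \<le> 12 * log_factor * objective I \<sigma> * inner_bound * (1 + log (3 / 2) cutoff)"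
proof -
  define D where "D = 12 * log_factor * objective I \<sigma>"
  let ?ind = "if 1 \<le> cutoff * (2 / 3) ^ (p - 1) then 1 else (0 :: real)"
  have D0: "0 \<le> D"
    using log_factor_ge_1 total_weight_le_objective[OF assms(2)] total_weight_ge_1 by (simp add: D_def)
  have p: "1 \<le> p" using bag_config_basic[OF assms(1)] by auto
  obtain q where between: "between_inner D p q xs"
    using bag_config_invariant[OF assms(1,2) D_def] by auto
  have "big_cost i xs \<le> D * inner_bound * real (big_iterations (p - 1)) + D * real q * ?ind"
    using between assms(3) unfolding between_inner_def by blast
  also have "D * real q * ?ind \<le> D * inner_bound * ?ind"
    using between D0 unfolding between_inner_def by (intro mult_right_mono mult_left_mono) auto
  also have "D * inner_bound * real (big_iterations (p - 1)) + D * inner_bound * ?ind =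
      D * inner_bound * real (big_iterations p)"
    using big_iterations_Suc[of "p - 1"] p by (simp add: algebra_simps)
  also have "\<dots> \<le> D * inner_bound * (1 + log (3 / 2) cutoff)"
    using big_iterations_le D0 inner_bound_ge_1 by (intro mult_left_mono) auto
  finally show ?thesis by (simp add: D_def)
qed

text \<open>Non-zero unsatisfied weight is at least 1. So if \<open>cutoff\<close> is the total
  weight, dropped steps have weight 0; otherwise \<open>cutoff\<close> is the number of elements
  \<open>n\<close>, and at most \<open>n\<close> dropped steps cost at most
  \<open>total_weight I / n\<close> each.\<close>

lemma cost_le_big_cost:
  assumes i: "i \<in> agents I" and "length xs \<le> num_elems I"
  shows "(\<Sum>t<length xs. unsat_weight i (set (take t xs))) \<le> big_cost i xs + total_weight I"
proof -
  let ?W = "total_weight I" and ?n = "real (num_elems I)"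
  have small: "w \<le> ?W / ?n" if w: "cutoff * w < ?W" "w = unsat_weight i S" for w S
  proof (cases "unsat I i S = {}")
    case True
    then show ?thesis using w(2) total_weight_ge_1 by simp
  next
    case False
    then obtain j where j: "j \<in> unsat I i S" by auto
    have "weight I i j \<le> w" unfolding w(2)
      by (rule member_le_sum[OF j]) (use weight_ge_1[OF i] in \<open>force simp: unsat_def\<close>)+
    then have "1 \<le> w" using weight_ge_1[OF i, of j] j by (auto simp: unsat_def)
    then have "?W * 1 \<le> ?W * w" using total_weight_ge_1 by (intro mult_left_mono) auto
    then have "cutoff \<noteq> ?W" using w(1) by auto
    then have "cutoff = ?n" by (auto simp: cutoff_def min_def split: if_splits)
    then have "w * ?n \<le> ?W" using w(1) by (simp add: mult.commute)
    then show ?thesis using sizes by (subst pos_le_divide_eq) auto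
  qed
  have "(\<Sum>t<length xs. unsat_weight i (set (take t xs))) \<le>
     (\<Sum>t<length xs. (if ?W \<le> cutoff * unsat_weight i (set (take t xs))
       then unsat_weight i (set (take t xs)) else 0) + ?W / ?n)"
  proof (rule sum_mono)
    fix t
    show "unsat_weight i (set (take t xs)) \<le> (if ?W \<le> cutoff * unsat_weight i (set (take t xs))
       then unsat_weight i (set (take t xs)) else 0) + ?W / ?n"
    proof (cases "?W \<le> cutoff * unsat_weight i (set (take t xs))")
      case True
      then show ?thesis using total_weight_ge_1 by simp
    next
      case False
      then have "unsat_weight i (set (take t xs)) \<le> ?W / ?n"
        by (intro small[OF _ refl]) simp
      then show ?thesis unfolding if_not_P[OF False] by simp
    qed
  qed
  also have "\<dots> = big_cost i xs + real (length xs) * (?W / ?n)"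
    by (simp add: sum.distrib big_cost_def)
  also have "real (length xs) * (?W / ?n) \<le> ?n * (?W / ?n)"
    using assms(2) total_weight_ge_1 by (intro mult_right_mono) auto
  also have "\<dots> = ?W" using sizes by simp
  finally show ?thesis by simp
qed

text \<open>The function is unsatisfied at all prefix lengths from 1 to its cover time minus 1, and
  these lie below \<open>length xs\<close>. The summand 1 is the covering step itself, needed when
  the function is 1 on the empty set.\<close>

lemma cov_le_count:
  assumes \<pi>: "\<pi> = xs @ ys" "\<pi> \<in> permutations_of_set (ground I)"
    and ij: "i \<in> agents I" "j \<in> fun_ids I" and sat: "fn I i j (set xs) = 1"
  shows "real (cov (fn I i j) \<pi>) \<le> 1 + (\<Sum>t<length xs. if j \<in> unsat I i (set (take t xs)) then 1 else 0)"
proof -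
  let ?c = "cov (fn I i j) \<pi>" and ?U = "{t. t < length xs \<and> j \<in> unsat I i (set (take t xs))}"
  note facts = perm_facts[OF \<pi>(2)]
  have "{1..<?c} \<subseteq> ?U"
  proof
    fix t assume t: "t \<in> {1..<?c}"
    then have "fn I i j (set (take t \<pi>)) \<noteq> 1" using cov_le_iff[OF \<pi>(2) ij, of t] by auto
    then have less: "fn I i j (set (take t \<pi>)) < 1"
      using fn_le_1[OF ij set_take_perm[OF \<pi>(2)]] by (simp add: less_le)
    have "t < length xs"
    proof (rule ccontr)
      assume "\<not> t < length xs"
      then have "set xs \<subseteq> set (take t \<pi>)" using \<pi>(1) by auto
      then have "fn I i j (set xs) \<le> fn I i j (set (take t \<pi>))"
        by (rule fn_mono[OF ij _ set_take_perm[OF \<pi>(2)]])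
      then show False using less sat by simp
    qed
    then show "t \<in> ?U" using less ij(2) \<pi>(1) by (simp add: unsat_def)
  qed
  then have "card {1..<?c} \<le> card ?U" by (rule card_mono[rotated]) simp
  then have "real ?c \<le> 1 + real (card ?U)" by simp
  also have "real (card ?U) = (\<Sum>t<length xs. if j \<in> unsat I i (set (take t xs)) then 1 else 0)"
    by (simp add: sum.If_cases Collect_conj_eq lessThan_def)
  finally show ?thesis by simp
qed

text \<open>Double counting: exchanging the sums over functions and times turns weighted cover times
  into unsatisfied weight per step.\<close>

lemma agent_cost_le:
  assumes \<pi>: "\<pi> = xs @ ys" "\<pi> \<in> permutations_of_set (ground I)"
    and sat: "all_satisfied I (set xs)" and i: "i \<in> agents I"
  shows "(\<Sum>j\<in>fun_ids I. weight I i j * real (cov (fn I i j) \<pi>)) \<le>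
    total_weight I + (\<Sum>t<length xs. unsat_weight i (set (take t xs)))"
proof -
  let ?f = "\<lambda>t j. if j \<in> unsat I i (set (take t xs)) then 1 else (0 :: real)"
  have S: "set xs \<subseteq> ground I" using \<pi> by (auto simp: permutations_of_set_def)
  have sat': "fn I i j (set xs) = 1" if "j \<in> fun_ids I" for j
    using sat i that fn_le_1[OF i that S] by (force simp: all_satisfied_def unsat_def)
  have "(\<Sum>j\<in>fun_ids I. weight I i j * real (cov (fn I i j) \<pi>)) \<le>
      (\<Sum>j\<in>fun_ids I. weight I i j * (1 + (\<Sum>t<length xs. ?f t j)))"
  proof (intro sum_mono mult_left_mono)
    fix j assume j: "j \<in> fun_ids I"
    show "real (cov (fn I i j) \<pi>) \<le> 1 + (\<Sum>t<length xs. ?f t j)"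
      by (rule cov_le_count[OF \<pi> i j sat'[OF j]])
    show "0 \<le> weight I i j" using weight_ge_1[OF i j] by linarith
  qed
  also have "\<dots> = (\<Sum>j\<in>fun_ids I. weight I i j) + (\<Sum>t<length xs. \<Sum>j\<in>fun_ids I. weight I i j * ?f t j)"
    by (simp only: distrib_left mult_1_right sum.distrib sum_distrib_left)
      (subst sum.swap, rule refl)
  also have "(\<Sum>t<length xs. \<Sum>j\<in>fun_ids I. weight I i j * ?f t j) =
      (\<Sum>t<length xs. unsat_weight i (set (take t xs)))"
  proof (rule sum.cong[OF refl])
    fix t
    show "(\<Sum>j\<in>fun_ids I. weight I i j * ?f t j) = unsat_weight i (set (take t xs))"
      by (rule sum.mono_neutral_cong_right) (auto simp: unsat_def)
  qed
  finally show ?thesis using weight_sum_le_total[OF i] by linarith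
qed

text \<open>The factor is \<open>14 = 12 + 2\<close>: the covering steps and the dropped steps each
  add at most \<open>total_weight I \<le> objective I \<sigma>\<close>, and the other factors are at
  least 1.\<close>

lemma bag_output_objective:
  assumes out: "bag_output I \<pi>" and \<sigma>: "\<sigma> \<in> permutations_of_set (ground I)"
  shows "objective I \<pi> \<le> 14 * log_factor * inner_bound * (1 + log (3 / 2) cutoff) * objective I \<sigma>"
proof -
  let ?Obj = "objective I \<sigma>" and ?P = "1 + log (3 / 2) cutoff"
  obtain p xs ys where run: "bag_config I p None xs" "all_satisfied I (set xs)"
    and \<pi>: "\<pi> = xs @ ys" "\<pi> \<in> permutations_of_set (ground I)"
    using out unfolding bag_output_def by blast
  have len: "length xs \<le> num_elems I" using perm_facts(2)[OF \<pi>(2)] \<pi>(1) by simp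
  have W: "1 \<le> total_weight I" "total_weight I \<le> ?Obj"
    using total_weight_ge_1 total_weight_le_objective[OF \<sigma>] .
  have "1 \<le> ?P" using cutoff_ge_1 by simp
  then have "1 * 1 * 1 \<le> log_factor * inner_bound * ?P"
    using log_factor_ge_1 inner_bound_ge_1 by (intro mult_mono) auto
  then have "1 * ?Obj \<le> log_factor * inner_bound * ?P * ?Obj"
    using W by (intro mult_right_mono) auto
  then have Obj: "2 * (1 * ?Obj) \<le> 2 * (log_factor * inner_bound * ?P * ?Obj)"
    by (rule mult_left_mono) simp
  have "(\<Sum>j\<in>fun_ids I. weight I i j * real (cov (fn I i j) \<pi>)) \<le>
      14 * log_factor * inner_bound * ?P * ?Obj" if i: "i \<in> agents I" for i
  proof -
    have "(\<Sum>j\<in>fun_ids I. weight I i j * real (cov (fn I i j) \<pi>)) \<le>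
       2 * ?Obj + 12 * log_factor * ?Obj * inner_bound * ?P"
      using agent_cost_le[OF \<pi> run(2) i] cost_le_big_cost[OF i len] big_cost_None[OF run(1) \<sigma> i] W
      by linarith
    also have "\<dots> \<le> 2 * (log_factor * inner_bound * ?P * ?Obj) + 12 * log_factor * ?Obj * inner_bound * ?P"
      using Obj by linarith
    finally show ?thesis by (simp add: algebra_simps)
  qed
  then show ?thesis unfolding objective_def[of I \<pi>] by (subst Max_le_iff) auto
qed

lemma OPT_attained:
  obtains \<sigma> where "\<sigma> \<in> permutations_of_set (ground I)" "objective I \<sigma> = OPT I"
proof -
  have "OPT I \<in> objective I ` permutations_of_set (ground I)"
    unfolding OPT_def by (rule Min_in) simp_all
  then show thesis using that by auto
qed

end

section \<open>Change of base and the final constant\<close>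

lemma log_change_base_le:
  fixes b x :: real
  assumes "1 < b" "2 \<le> b ^ m" "1 \<le> x" "1 \<le> m"
  shows "1 + log b x \<le> real m * (1 + log 2 x)"
proof -
  have "ln 2 \<le> ln (b ^ m)" using assms by (intro ln_mono) auto
  then have ln2: "ln 2 \<le> real m * ln b" using assms by (simp add: ln_realpow)
  have "ln x * ln 2 \<le> ln x * (real m * ln b)" using ln2 assms by (intro mult_left_mono) auto
  then have "log b x \<le> real m * log 2 x"
    using assms by (simp add: log_def field_simps)
  then show ?thesis using assms by (simp add: distrib_left)
qed

theorem theorem3:
  shows "\<exists>C::real. C > 0 \<and>
    (\<forall>(I::srma) (\<pi>::nat list).
       valid_instance I \<longrightarrow> integer_weights I \<longrightarrow> bag_output I \<pi> \<longrightarrow>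
       objective I \<pi>
         \<le> C * (1 + ln (1 / min_marginal I))
             * (1 + log 2 (min (real (num_elems I)) (total_weight I)))
             * (1 + log 2 (real (num_agents I)))
             * OPT I)"
\<comment> \<open>The constant is \<open>14 * 3 * 2\<close>: changing to base 2 costs a factor 3
  from base \<open>4/3\<close>, since \<open>(4/3)^3 \<ge> 2\<close>, and a factor 2 from base
  \<open>3/2\<close>, since \<open>(3/2)^2 \<ge> 2\<close>.\<close>
proof (intro exI[of _ 84] conjI allI impI)
  fix I :: srma and \<pi> :: "nat list"
  assume "valid_instance I" and out: "bag_output I \<pi>"
  then interpret valid_srma I by unfold_locales
  obtain \<sigma> where \<sigma>: "\<sigma> \<in> permutations_of_set (ground I)" "objective I \<sigma> = OPT I"
    by (rule OPT_attained)
  let ?N = "1 + log 2 cutoff" and ?K = "1 + log 2 (real (num_agents I))"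
  have N: "1 + log (3 / 2) cutoff \<le> 2 * ?N"
    using log_change_base_le[of "3 / 2" 2 cutoff] cutoff_ge_1 by (simp add: power2_eq_square)
  have K: "inner_bound \<le> 3 * ?K"
    using log_change_base_le[of "4 / 3" 3 "real (num_agents I)"] sizes
    by (simp add: inner_bound_def power3_eq_cube)
  have pos: "0 \<le> OPT I" "0 \<le> ?N" "0 \<le> ?K"
    using total_weight_le_objective[OF \<sigma>(1)] total_weight_ge_1 \<sigma>(2) cutoff_ge_1 sizes
    by auto
  have "objective I \<pi> \<le> 14 * log_factor * inner_bound * (1 + log (3 / 2) cutoff) * OPT I"
    using bag_output_objective[OF out \<sigma>(1)] \<sigma>(2) by simp
  also have "\<dots> \<le> 14 * log_factor * (3 * ?K) * (2 * ?N) * OPT I"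
    using N K pos log_factor_ge_1 inner_bound_ge_1 cutoff_ge_1 by (intro mult_right_mono mult_mono) auto
  also have "\<dots> = 84 * log_factor * ?N * ?K * OPT I" by (simp add: algebra_simps)
  finally show "objective I \<pi> \<le> 84 * (1 + ln (1 / min_marginal I))
             * (1 + log 2 (min (real (num_elems I)) (total_weight I)))
             * (1 + log 2 (real (num_agents I))) * OPT I"
    by (simp only: log_factor_def cutoff_def)
qed simp

end
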